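(* Every $n$-vertex interval graph $G$ satisfies $\operatorname{tww}(G) \leq 2\lceil \sqrt{2n}\, \rceil$; in particular $\operatorname{tww}(G) \in O(\sqrt{n})$.
   Context: All graphs are finite, simple and undirected. For a finite family $\mathcal{I}$ of closed intervals on the real line, the corresponding interval graph $G_{\mathcal{I}}$ is the graph with vertex-set $\mathcal{I}$ in which two distinct vertices are adjacent if and only if the corresponding intervals have non-empty intersection; an interval graph is a graph (isomorphic to one) of this form. Twin-width: a trigraph is a graph together with a partition of its edge-set into black edges and red edges; an ordinary graph is regarded as a trigraph with all edges black. Contracting two distinct (not necessarily adjacent) vertices $u,v$ of a trigraph means replacing them by a single new vertex $w$ such that, for every other vertex $x$: $wx$ is a black edge if both $ux$ and $vx$ are black edges; $wx$ is a non-edge if neither $ux$ nor $vx$ is an edge; and $wx$ is a red edge otherwise. All other edges and their colours are unchanged. The red degree of a vertex is the number of red edges incident with it. A contraction sequence of an $n$-vertex graph $G$ is a sequence of trigraphs $G = G_n, \dots, G_1 = K_1$ where each $G_s$ is obtained from $G_{s+1}$ by one contraction; it is a $d$-sequence if every trigraph in it has maximum red degree at most $d$. The twin-width $\operatorname{tww}(G)$ is the minimum integer $d$ such that $G$ has a $d$-sequence. *)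

theory Defs
  imports
    "Graph_Theory.Graph_Theory"
    "HOL-Library.Landau_Symbols"
    Complex_Main
begin

text \<open>
  Finite simple undirected graphs are finite, symmetric, loop-free digraphs without parallel arcs
  (\<^locale>\<open>pair_graph\<close>): an edge \<open>uv\<close> is represented by the two arcs \<open>(u, v)\<close> and \<open>(v, u)\<close>.
\<close>

section \<open>Interval graphs\<close>

text \<open>
  The family of intervals is indexed, so an interval may occur in it repeatedly, and the index
  stands for the interval as a vertex.
\<close>

definition interval_graph :: "'i set \<Rightarrow> ('i \<Rightarrow> real set) \<Rightarrow> 'i pair_pre_digraph" where
  "interval_graph J I =
     \<lparr>pverts = J, parcs = {(i, j). i \<in> J \<and> j \<in> J \<and> i \<noteq> j \<and> I i \<inter> I j \<noteq> {}}\<rparr>"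

text \<open>Natural numbers suffice as indices, since the family is finite.\<close>

definition is_interval_graph :: "'a pair_pre_digraph \<Rightarrow> bool" where
  "is_interval_graph G \<longleftrightarrow> pair_graph G \<and>
     (\<exists>(J :: nat set) I. finite J \<and> (\<forall>i\<in>J. \<exists>a b. a \<le> b \<and> I i = {a..b}) \<and>
        digraph_iso (with_proj G) (with_proj (interval_graph J I)))"

section \<open>Trigraphs and contractions\<close>

text \<open>As for graphs, an edge of either colour is represented by two opposite pairs.\<close>

record 'a trigraph =
  tverts :: "'a set"
  black :: "'a rel"
  red :: "'a rel"

definition underlying_graph :: "'a trigraph \<Rightarrow> 'a pair_pre_digraph" where
  "underlying_graph T = \<lparr>pverts = tverts T, parcs = black T \<union> red T\<rparr>"

definition is_trigraph :: "'a trigraph \<Rightarrow> bool" where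
  "is_trigraph T \<longleftrightarrow> pair_graph (underlying_graph T) \<and>
     sym (black T) \<and> sym (red T) \<and> black T \<inter> red T = {}"

definition trigraph_of :: "'a pair_pre_digraph \<Rightarrow> 'a trigraph" where
  "trigraph_of G = \<lparr>tverts = pverts G, black = parcs G, red = {}\<rparr>"

definition red_degree :: "'a trigraph \<Rightarrow> 'a \<Rightarrow> nat" where
  "red_degree T v = card {x. (v, x) \<in> red T}"

text \<open>Replaces \<open>u\<close> and \<open>v\<close> by \<open>w\<close>.\<close>

definition contract :: "'a \<Rightarrow> 'a \<Rightarrow> 'a \<Rightarrow> 'a trigraph \<Rightarrow> 'a trigraph" where
  "contract u v w T =
     (let X = tverts T - {u, v};
          E = black T \<union> red T;
          B = {x \<in> X. (u, x) \<in> black T \<and> (v, x) \<in> black T};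
          N = {x \<in> X. (u, x) \<notin> E \<and> (v, x) \<notin> E};
          R = X - B - N
      in \<lparr>tverts = insert w X,
          black = (black T \<inter> X \<times> X) \<union> {w} \<times> B \<union> B \<times> {w},
          red = (red T \<inter> X \<times> X) \<union> {w} \<times> R \<union> R \<times> {w}\<rparr>)"

text \<open>
  The new vertex only has to differ from the vertices that remain. It may reuse the name \<open>u\<close> or
  \<open>v\<close>, so that contractions are possible even if the type of vertices has no further elements.
\<close>

definition is_contraction :: "'a trigraph \<Rightarrow> 'a trigraph \<Rightarrow> bool" where
  "is_contraction T T' \<longleftrightarrow>
     (\<exists>u\<in>tverts T. \<exists>v\<in>tverts T. u \<noteq> v \<and>
        (\<exists>w. w \<notin> tverts T - {u, v} \<and> T' = contract u v w T))"

lemma is_trigraph_trigraph_of: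
  assumes "pair_graph G"
  shows "is_trigraph (trigraph_of G)"
proof -
  interpret pair_graph G by fact
  have "underlying_graph (trigraph_of G) = G"
    by (simp add: underlying_graph_def trigraph_of_def)
  moreover have "sym (parcs G)"
    using pair_sym_arcs by (simp add: symmetric_def)
  ultimately show ?thesis
    using assms by (simp add: is_trigraph_def trigraph_of_def sym_def)
qed

lemma is_trigraph_iff:
  "is_trigraph T \<longleftrightarrow> finite (tverts T) \<and> black T \<subseteq> tverts T \<times> tverts T \<and> red T \<subseteq> tverts T \<times> tverts T \<and>
     irrefl (black T) \<and> irrefl (red T) \<and> sym (black T) \<and> sym (red T) \<and> black T \<inter> red T = {}"
  (is "?L \<longleftrightarrow> ?R")
proof
  assume L: ?L
  then interpret pair_graph "underlying_graph T" by (simp add: is_trigraph_def)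
  show ?R
    using L pair_finite_verts in_arcsD1 in_arcsD2 pair_no_loops
    by (fastforce simp: is_trigraph_def underlying_graph_def irrefl_def)
next
  assume R: ?R
  then have "finite (black T \<union> red T)"
    by (meson finite_SigmaI finite_UnI finite_subset)
  with R have "pair_graph (underlying_graph T)"
    by unfold_locales (auto simp: underlying_graph_def irrefl_def symmetric_def sym_def)
  with R show ?L by (simp add: is_trigraph_def)
qed

lemma is_trigraph_contraction:
  assumes "is_trigraph T" "is_contraction T T'"
  shows "is_trigraph T'"
proof -
  obtain u v w where w: "w \<notin> tverts T - {u, v}" and T': "T' = contract u v w T"
    using assms(2) by (auto simp: is_contraction_def)
  define X where "X = tverts T - {u, v}"
  define B where "B = {x \<in> X. (u, x) \<in> black T \<and> (v, x) \<in> black T}"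
  define R where "R = X - B - {x \<in> X. (u, x) \<notin> black T \<union> red T \<and> (v, x) \<notin> black T \<union> red T}"
  have sub: "B \<subseteq> X" "R \<subseteq> X" "B \<inter> R = {}" "w \<notin> X"
    using w by (auto simp: B_def R_def X_def)
  have T'_eq: "T' = \<lparr>tverts = insert w X,
      black = (black T \<inter> X \<times> X) \<union> {w} \<times> B \<union> B \<times> {w},
      red = (red T \<inter> X \<times> X) \<union> {w} \<times> R \<union> R \<times> {w}\<rparr>"
    unfolding T' contract_def Let_def X_def B_def R_def by simp
  have T: "finite (tverts T)" "irrefl (black T)" "irrefl (red T)" "sym (black T)" "sym (red T)"
      "black T \<inter> red T = {}"
    using assms(1) by (auto simp: is_trigraph_iff)
  have "finite X" using T(1) by (simp add: X_def)
  moreover have "irrefl (black T')" "irrefl (red T')"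
    using T sub by (auto simp: T'_eq irrefl_def)
  moreover have "sym (black T')" "sym (red T')"
    using T by (auto simp: T'_eq sym_def)
  moreover have "black T' \<inter> red T' = {}"
    using T(6) sub by (auto simp: T'_eq)
  moreover have "black T' \<subseteq> tverts T' \<times> tverts T'" "red T' \<subseteq> tverts T' \<times> tverts T'"
    using sub by (auto simp: T'_eq)
  ultimately show ?thesis
    by (simp add: is_trigraph_iff T'_eq)
qed

section \<open>Twin-width\<close>

text \<open>
  \<open>S s\<close> is the trigraph \<open>G\<^sub>s\<close> of the sequence, which has \<open>s\<close> vertices; the values of \<open>S\<close> outside
  of \<open>1, \<dots>, n\<close> are irrelevant.
\<close>

definition contraction_sequence :: "'a pair_pre_digraph \<Rightarrow> (nat \<Rightarrow> 'a trigraph) \<Rightarrow> bool" where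
  "contraction_sequence G S \<longleftrightarrow>
     (\<forall>s\<in>{1..card (pverts G)}. is_trigraph (S s)) \<and>
     S (card (pverts G)) = trigraph_of G \<and>
     (\<forall>s\<in>{1..<card (pverts G)}. is_contraction (S (Suc s)) (S s)) \<and>
     complete_digraph 1 (with_proj (underlying_graph (S 1)))"

definition d_sequence :: "nat \<Rightarrow> 'a pair_pre_digraph \<Rightarrow> (nat \<Rightarrow> 'a trigraph) \<Rightarrow> bool" where
  "d_sequence d G S \<longleftrightarrow> contraction_sequence G S \<and>
     (\<forall>s\<in>{1..card (pverts G)}. \<forall>v\<in>tverts (S s). red_degree (S s) v \<le> d)"

text \<open>Meaningful for non-empty graphs, since only these have a contraction sequence.\<close>

definition tww :: "'a pair_pre_digraph \<Rightarrow> nat" where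
  "tww G = (LEAST d. \<exists>S. d_sequence d G S)"

section \<open>Asymptotics over interval graphs\<close>

text \<open>
  \<open>O[interval_graphs_at_top]\<close> expresses a bound that is uniform over all interval graphs with
  sufficiently many vertices.
\<close>

definition interval_graphs_at_top :: "'a pair_pre_digraph filter" where
  "interval_graphs_at_top =
     inf (filtercomap (\<lambda>G. card (pverts G)) at_top) (principal {G. is_interval_graph G})"

lemma eventually_interval_graphs_at_top:
  "eventually P interval_graphs_at_top \<longleftrightarrow>
     (\<exists>N. \<forall>G. is_interval_graph G \<longrightarrow> card (pverts G) \<ge> N \<longrightarrow> P G)"
  by (auto simp: interval_graphs_at_top_def eventually_inf_principal
      eventually_filtercomap_at_top_linorder)

end

theory Submission
  imports Defs "HOL-Library.Product_Lexorder"
begin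

text \<open>
  Sort the \<open>2 n\<close> endpoints, left endpoints before right endpoints in case of a tie, and cut the
  sorted list into at most \<open>m = \<lceil>sqrt (2 n)\<rceil>\<close> blocks of size \<open>m\<close>. An interval belongs to the cell
  \<open>(i, j)\<close> if its left endpoint is in block \<open>i\<close> and its right endpoint in block \<open>j\<close>. If two parts
  of a partition that refines the cells are joined by a red edge, then the block of the left
  endpoints of one of them is the block of the right endpoints of the other. Hence, while the
  vertices are merged into the cells, the red degree is at most the number \<open>2 m\<close> of endpoints in two
  blocks. Afterwards, the first two blocks are repeatedly united, and the number of cells in the
  relevant rows and columns gives the same bound.
\<close>

section \<open>Quotients of a graph\<close>

text \<open>The parts of the partition are the fibres of \<open>\<rho>\<close>, and \<open>\<rho>\<close> also provides their names.\<close>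

definition quotient_trigraph :: "'a set \<Rightarrow> 'a rel \<Rightarrow> ('a \<Rightarrow> 'a) \<Rightarrow> 'a trigraph" where
  "quotient_trigraph V E \<rho> =
     \<lparr>tverts = \<rho> ` V,
      black = {(x, y). x \<in> \<rho> ` V \<and> y \<in> \<rho> ` V \<and> x \<noteq> y \<and>
        (\<forall>u\<in>V. \<forall>v\<in>V. \<rho> u = x \<longrightarrow> \<rho> v = y \<longrightarrow> (u, v) \<in> E)},
      red = {(x, y). x \<noteq> y \<and>
        (\<exists>u\<in>V. \<exists>v\<in>V. \<rho> u = x \<and> \<rho> v = y \<and> (u, v) \<in> E) \<and>
        (\<exists>u\<in>V. \<exists>v\<in>V. \<rho> u = x \<and> \<rho> v = y \<and> (u, v) \<notin> E)}\<rparr>"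

text \<open>Functions stand for the partitions into their fibres, so the types of their values may
  differ. Mutual refinement expresses that two partitions agree.\<close>

definition refines_on :: "'a set \<Rightarrow> ('a \<Rightarrow> 'b) \<Rightarrow> ('a \<Rightarrow> 'c) \<Rightarrow> bool" where
  "refines_on V f g \<longleftrightarrow> (\<forall>u\<in>V. \<forall>v\<in>V. f u = f v \<longrightarrow> g u = g v)"

lemma refines_on_trans: "refines_on V f g \<Longrightarrow> refines_on V g h \<Longrightarrow> refines_on V f h"
  unfolding refines_on_def by blast

lemma tverts_quotient [simp]: "tverts (quotient_trigraph V E \<rho>) = \<rho> ` V"
  by (simp add: quotient_trigraph_def)

lemma quotient_trigraph_id:
  assumes "pair_graph G"
  shows "quotient_trigraph (pverts G) (parcs G) id = trigraph_of G"
proof -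
  interpret pair_graph G by fact
  show ?thesis
    by (auto simp: quotient_trigraph_def trigraph_of_def dest: in_arcsD1 in_arcsD2 pair_no_loops)
qed

text \<open>A third fibre is completely joined to the union of two fibres iff it is completely
  joined to both, and has no edge to the union iff it has none to either. This is the rule for the
  colours in a contraction. The union keeps the name \<open>p\<close>.\<close>

lemma contract_quotient:
  assumes "sym E" and p: "p \<in> \<rho> ` V" and q: "q \<in> \<rho> ` V" and "p \<noteq> q"
  shows "contract p q p (quotient_trigraph V E \<rho>) =
    quotient_trigraph V E (\<lambda>v. if \<rho> v = q then p else \<rho> v)"
proof -
  have E: "(x, y) \<in> E \<longleftrightarrow> (y, x) \<in> E" for x y
    using \<open>sym E\<close> by (auto simp: sym_def)
  define \<sigma> where "\<sigma> v = (if \<rho> v = q then p else \<rho> v)" for v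
  define all where "all x y \<longleftrightarrow> (\<forall>u\<in>V. \<forall>v\<in>V. \<rho> u = x \<longrightarrow> \<rho> v = y \<longrightarrow> (u, v) \<in> E)" for x y
  define ex where "ex x y \<longleftrightarrow> (\<exists>u\<in>V. \<exists>v\<in>V. \<rho> u = x \<and> \<rho> v = y \<and> (u, v) \<in> E)" for x y
  define all' where "all' x y \<longleftrightarrow> (\<forall>u\<in>V. \<forall>v\<in>V. \<sigma> u = x \<longrightarrow> \<sigma> v = y \<longrightarrow> (u, v) \<in> E)" for x y
  define ex' where "ex' x y \<longleftrightarrow> (\<exists>u\<in>V. \<exists>v\<in>V. \<sigma> u = x \<and> \<sigma> v = y \<and> (u, v) \<in> E)" for x y
  define X where "X = \<rho> ` V - {p, q}"
  have \<rho>: "quotient_trigraph V E \<rho> =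
    \<lparr>tverts = \<rho> ` V,
      black = {(x, y). x \<in> \<rho> ` V \<and> y \<in> \<rho> ` V \<and> x \<noteq> y \<and> all x y},
      red = {(x, y). x \<noteq> y \<and> ex x y \<and> x \<in> \<rho> ` V \<and> y \<in> \<rho> ` V \<and> \<not> all x y}\<rparr>"
    by (auto simp: quotient_trigraph_def all_def ex_def)
  have \<sigma>: "quotient_trigraph V E \<sigma> =
    \<lparr>tverts = \<sigma> ` V,
      black = {(x, y). x \<in> \<sigma> ` V \<and> y \<in> \<sigma> ` V \<and> x \<noteq> y \<and> all' x y},
      red = {(x, y). x \<noteq> y \<and> ex' x y \<and> x \<in> \<sigma> ` V \<and> y \<in> \<sigma> ` V \<and> \<not> all' x y}\<rparr>"
    by (auto simp: quotient_trigraph_def all'_def ex'_def)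
  have im: "\<sigma> ` V = insert p X"
    using p q \<open>p \<noteq> q\<close> by (auto simp: \<sigma>_def X_def image_iff)
  have eq: "\<sigma> v = x \<longleftrightarrow> \<rho> v = x" if "x \<in> X" for v x
    using that by (auto simp: \<sigma>_def X_def)
  have eqp: "\<sigma> v = p \<longleftrightarrow> \<rho> v = p \<or> \<rho> v = q" for v
    by (auto simp: \<sigma>_def)
  have old: "all' x y = all x y" "ex' x y = ex x y" if "x \<in> X" "y \<in> X" for x y
    using that by (auto simp: all'_def all_def ex'_def ex_def eq)
  have new: "all' p x \<longleftrightarrow> all p x \<and> all q x" "ex' p x \<longleftrightarrow> ex p x \<or> ex q x" if "x \<in> X" for x
    using that by (auto simp: all'_def all_def ex'_def ex_def eq eqp)
  have swap: "all' x y \<longleftrightarrow> all' y x" "ex' x y \<longleftrightarrow> ex' y x" for x y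
    using E unfolding all'_def ex'_def by blast+
  \<comment> \<open>Fibres over the image are nonempty. Hence \<open>ex\<close> holds for distinct
    parts exactly when they are joined by an edge of either colour, which identifies the common
    non-neighbours as \<open>N\<close>.\<close>
  have all_ex: "all x y \<Longrightarrow> ex x y" if "x \<in> \<rho> ` V" "y \<in> \<rho> ` V" for x y
    using that by (auto simp: all_def ex_def)
  define P where "P = {x \<in> X. all p x \<and> all q x}"
  define N where "N = {x \<in> X. \<not> ex p x \<and> \<not> ex q x}"
  have P': "P = {x \<in> X. all' p x}" and N': "N = {x \<in> X. \<not> ex' p x}"
    by (auto simp: P_def N_def new)
  have PE: "{x \<in> X. (p, x) \<in> black (quotient_trigraph V E \<rho>) \<and> (q, x) \<in> black (quotient_trigraph V E \<rho>)} = P"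
    using p q by (auto simp: \<rho> P_def X_def)
  have NE: "{x \<in> X. (p, x) \<notin> black (quotient_trigraph V E \<rho>) \<union> red (quotient_trigraph V E \<rho>) \<and>
      (q, x) \<notin> black (quotient_trigraph V E \<rho>) \<union> red (quotient_trigraph V E \<rho>)} = N"
    using p q all_ex unfolding \<rho> N_def X_def by (simp, blast)
  have c: "contract p q p (quotient_trigraph V E \<rho>) =
      \<lparr>tverts = insert p X,
       black = (black (quotient_trigraph V E \<rho>) \<inter> X \<times> X) \<union> {p} \<times> P \<union> P \<times> {p},
       red = (red (quotient_trigraph V E \<rho>) \<inter> X \<times> X) \<union> {p} \<times> (X - P - N) \<union> (X - P - N) \<times> {p}\<rparr>"
    unfolding contract_def Let_def tverts_quotient X_def[symmetric] PE NE ..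
  have pX: "p \<notin> X" and XV: "X \<subseteq> \<rho> ` V" by (auto simp: X_def)
  have "black (quotient_trigraph V E \<rho>) \<inter> X \<times> X = {(x, y). x \<in> X \<and> y \<in> X \<and> x \<noteq> y \<and> all' x y}"
    "red (quotient_trigraph V E \<rho>) \<inter> X \<times> X = {(x, y). x \<in> X \<and> y \<in> X \<and> x \<noteq> y \<and> ex' x y \<and> \<not> all' x y}"
    using XV by (auto simp: \<rho> old)
  then have "contract p q p (quotient_trigraph V E \<rho>) = quotient_trigraph V E \<sigma>"
    unfolding c \<sigma> im using pX swap by (auto simp: P' N')
  then show ?thesis by (simp add: \<sigma>_def[abs_def])
qed

section \<open>Sequences of contractions\<close>

definition degree_bounded :: "nat \<Rightarrow> 'a trigraph \<Rightarrow> bool" where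
  "degree_bounded d T \<longleftrightarrow> (\<forall>v\<in>tverts T. red_degree T v \<le> d)"

text \<open>Only the result of the contraction is tested, so the start of a chain needs a degree
  bound of its own.\<close>

definition bounded_contraction :: "nat \<Rightarrow> 'a trigraph \<Rightarrow> 'a trigraph \<Rightarrow> bool" where
  "bounded_contraction d T T' \<longleftrightarrow> is_contraction T T' \<and> degree_bounded d T'"

lemma card_contraction:
  assumes "is_trigraph T" "is_contraction T T'"
  shows "card (tverts T) = Suc (card (tverts T'))"
proof -
  obtain u v w where uv: "u \<in> tverts T" "v \<in> tverts T" "u \<noteq> v" and w: "w \<notin> tverts T - {u, v}"
    and T': "T' = contract u v w T"
    using assms(2) by (auto simp: is_contraction_def)
  have fin: "finite (tverts T)"
    using assms(1) by (simp add: is_trigraph_iff)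
  have "tverts T' = insert w (tverts T - {u, v})"
    by (simp add: T' contract_def Let_def)
  then have "card (tverts T') = Suc (card (tverts T - {u, v}))"
    using w fin by simp
  also have "card (tverts T - {u, v}) = card (tverts T) - 2"
    using uv by (simp add: card_Diff_subset)
  finally show ?thesis
    using card_mono[OF fin, of "{u, v}"] uv by simp
qed

text \<open>Each contraction removes exactly one vertex, so the numbers of vertices index a chain
  without gaps. Extending the chain fills the index just below those in use.\<close>

lemma contraction_chain_indexed:
  assumes "(bounded_contraction d)\<^sup>*\<^sup>* T T'" "is_trigraph T" "degree_bounded d T"
  shows "\<exists>S. S (card (tverts T)) = T \<and> S (card (tverts T')) = T' \<and>
    card (tverts T') \<le> card (tverts T) \<and>
    (\<forall>s\<in>{card (tverts T')..card (tverts T)}. is_trigraph (S s) \<and> degree_bounded d (S s)) \<and>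
    (\<forall>s\<in>{card (tverts T')..<card (tverts T)}. is_contraction (S (Suc s)) (S s))"
  using assms(1)
proof (induction rule: rtranclp_induct)
  case base
  show ?case by (rule exI[of _ "\<lambda>_. T"]) (use assms in auto)
next
  case (step T' T'')
  then obtain S where S: "S (card (tverts T)) = T" "S (card (tverts T')) = T'"
    "card (tverts T') \<le> card (tverts T)"
    "\<And>s. s \<in> {card (tverts T')..card (tverts T)} \<Longrightarrow> is_trigraph (S s) \<and> degree_bounded d (S s)"
    "\<And>s. s \<in> {card (tverts T')..<card (tverts T)} \<Longrightarrow> is_contraction (S (Suc s)) (S s)"
    by blast
  have T': "is_trigraph T'" using S(2-4) by force
  have con: "is_contraction T' T''" and bd: "degree_bounded d T''"
    using step.hyps(2) by (auto simp: bounded_contraction_def)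
  have cd: "card (tverts T') = Suc (card (tverts T''))"
    using T' con by (rule card_contraction)
  have T'': "is_trigraph T''" using T' con by (rule is_trigraph_contraction)
  define c where "c = card (tverts T'')"
  define S' where "S' = S(c := T'')"
  have eq: "S' s = S s" if "s \<noteq> c" for s using that by (simp add: S'_def)
  have "is_trigraph (S' s) \<and> degree_bounded d (S' s)" if "s \<in> {c..card (tverts T)}" for s
    using S(4)[of s] that T'' bd cd by (cases "s = c") (auto simp: S'_def c_def)
  moreover have "is_contraction (S' (Suc s)) (S' s)" if "s \<in> {c..<card (tverts T)}" for s
    using S(2) S(5)[of s] that con cd by (cases "s = c") (auto simp: S'_def c_def)
  moreover have "S' (card (tverts T)) = T" "S' c = T''" "c \<le> card (tverts T)"
    using S(1,3) cd by (auto simp: S'_def c_def)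
  ultimately show ?case unfolding c_def by blast
qed

lemma tww_le_chain:
  assumes G: "pair_graph G" and bd: "degree_bounded d (trigraph_of G)"
    and chain: "(bounded_contraction d)\<^sup>*\<^sup>* (trigraph_of G) T" and T: "card (tverts T) = 1"
  shows "tww G \<le> d"
proof -
  have V: "tverts (trigraph_of G) = pverts G" by (simp add: trigraph_of_def)
  obtain S where S: "S (card (pverts G)) = trigraph_of G" "S 1 = T"
    "1 \<le> card (pverts G)"
    "\<And>s. s \<in> {1..card (pverts G)} \<Longrightarrow> is_trigraph (S s) \<and> degree_bounded d (S s)"
    "\<And>s. s \<in> {1..<card (pverts G)} \<Longrightarrow> is_contraction (S (Suc s)) (S s)"
    using contraction_chain_indexed[OF chain is_trigraph_trigraph_of[OF G] bd]
    unfolding T V by blast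
  have "is_trigraph T" using S(2,3) S(4)[of 1] by simp
  moreover obtain x where x: "tverts T = {x}"
    using T by (auto simp: card_1_singleton_iff)
  ultimately have "black T \<union> red T = {}"
    by (fastforce simp: is_trigraph_iff irrefl_def)
  then have "complete_digraph 1 (with_proj (underlying_graph (S 1)))"
    unfolding complete_digraph_pair_def using S(2) x by (auto simp: underlying_graph_def)
  then have "d_sequence d G S"
    using S unfolding d_sequence_def contraction_sequence_def degree_bounded_def by auto
  then show ?thesis
    unfolding tww_def by (intro Least_le) blast
qed

text \<open>While a partition is strictly finer than that of \<open>g\<close>, two of its parts lie
  in one fibre of \<open>g\<close> and can be merged. The bound is assumed for every partition
  between \<open>\<rho>\<close> and \<open>g\<close>, so the order of merging does not
  matter.\<close>

lemma quotient_chain: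
  assumes V: "finite V" and E: "sym E" and "refines_on V \<rho> g"
    and bd: "\<And>\<sigma>. refines_on V \<rho> \<sigma> \<Longrightarrow> refines_on V \<sigma> g \<Longrightarrow> degree_bounded d (quotient_trigraph V E \<sigma>)"
  shows "\<exists>\<sigma>. (bounded_contraction d)\<^sup>*\<^sup>* (quotient_trigraph V E \<rho>) (quotient_trigraph V E \<sigma>) \<and>
    refines_on V \<sigma> g \<and> refines_on V g \<sigma>"
  using bd \<open>refines_on V \<rho> g\<close>
proof (induction "card (\<rho> ` V)" arbitrary: \<rho> rule: less_induct)
  case less
  show ?case
  proof (cases "refines_on V g \<rho>")
    case True
    with less.prems show ?thesis by blast
  next
    case False
    then obtain u v where uv: "u \<in> V" "v \<in> V" "g u = g v" "\<rho> u \<noteq> \<rho> v"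
      by (auto simp: refines_on_def)
    define \<tau> where "\<tau> w = (if \<rho> w = \<rho> v then \<rho> u else \<rho> w)" for w
    have \<rho>\<tau>: "refines_on V \<rho> \<tau>"
      by (auto simp: refines_on_def \<tau>_def)
    have \<tau>g: "refines_on V \<tau> g"
      unfolding refines_on_def
    proof (intro ballI impI)
      fix a b assume ab: "a \<in> V" "b \<in> V" "\<tau> a = \<tau> b"
      \<comment> \<open>Two points identified by \<open>\<tau>\<close> share a fibre of
        \<open>\<rho>\<close>, or one lies in the fibre of \<open>u\<close> and the other in that of
        \<open>v\<close>; \<open>g u = g v\<close> settles the second case.\<close>
      have "\<rho> x = \<rho> y \<Longrightarrow> g x = g y" if "x \<in> V" "y \<in> V" for x y
        using less.prems(2) that unfolding refines_on_def by blast
      from this[of a v] this[of b v] this[of a b] this[of u b] this[of a u] show "g a = g b"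
        using ab uv by (simp add: \<tau>_def split: if_splits)
    qed
    \<comment> \<open>The merged part is named \<open>\<rho> u\<close>, so the value
      \<open>\<rho> v\<close> disappears and the number of parts decreases.\<close>
    have "\<tau> ` V \<subseteq> \<rho> ` V" "\<rho> v \<notin> \<tau> ` V"
      using uv by (auto simp: \<tau>_def)
    with uv(2) have "\<tau> ` V \<subset> \<rho> ` V" by blast
    then have "card (\<tau> ` V) < card (\<rho> ` V)"
      using V by (intro psubset_card_mono) auto
    then obtain \<sigma> where \<sigma>: "(bounded_contraction d)\<^sup>*\<^sup>* (quotient_trigraph V E \<tau>) (quotient_trigraph V E \<sigma>)"
      "refines_on V \<sigma> g" "refines_on V g \<sigma>"
      using less.hyps[of \<tau>] less.prems(1) \<rho>\<tau> \<tau>g refines_on_trans by blast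
    have "contract (\<rho> u) (\<rho> v) (\<rho> u) (quotient_trigraph V E \<rho>) = quotient_trigraph V E \<tau>"
      using uv E by (simp add: contract_quotient \<tau>_def[abs_def])
    then have "is_contraction (quotient_trigraph V E \<rho>) (quotient_trigraph V E \<tau>)"
      unfolding is_contraction_def using uv
      by (intro bexI[of _ "\<rho> u"] bexI[of _ "\<rho> v"] conjI exI[of _ "\<rho> u"]) auto
    then have "bounded_contraction d (quotient_trigraph V E \<rho>) (quotient_trigraph V E \<tau>)"
      using less.prems(1) \<rho>\<tau> \<tau>g by (simp add: bounded_contraction_def)
    with \<sigma> show ?thesis by (meson converse_rtranclp_into_rtranclp)
  qed
qed

section \<open>Intervals with distinct endpoints\<close>

text \<open>An element with the largest key is put last, and induction places the others. Equal keys
  are ordered arbitrarily.\<close>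

lemma ex_monotone_enumeration:
  fixes key :: "'b \<Rightarrow> 'k :: linorder"
  assumes "finite S"
  shows "\<exists>pos. inj_on pos S \<and> pos ` S \<subseteq> {..<card S} \<and>
    (\<forall>x\<in>S. \<forall>y\<in>S. key x < key y \<longrightarrow> pos x < (pos y :: nat))"
  using assms
proof (induction "card S" arbitrary: S)
  case 0
  then show ?case by simp
next
  case (Suc n)
  then have "S \<noteq> {}" by auto
  then have "Max (key ` S) \<in> key ` S"
    using Suc.prems by (intro Max_in) auto
  then obtain z where "z \<in> S" "key z = Max (key ` S)" by auto
  then have z: "z \<in> S" "\<And>x. x \<in> S \<Longrightarrow> key x \<le> key z"
    using Suc.prems by auto
  have n: "n = card (S - {z})" using Suc.hyps(2) Suc.prems z(1) by simp
  with Suc.hyps(1)[of "S - {z}"] Suc.prems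
  obtain pos where pos: "inj_on pos (S - {z})" "pos ` (S - {z}) \<subseteq> {..<n}"
    "\<And>x y. x \<in> S - {z} \<Longrightarrow> y \<in> S - {z} \<Longrightarrow> key x < key y \<Longrightarrow> pos x < (pos y :: nat)"
    by auto
  have S: "S = insert z (S - {z})" using z(1) by auto
  have "inj_on (pos(z := n)) (insert z (S - {z}))"
    using pos(1,2) by (auto simp: inj_on_def)
  then have "inj_on (pos(z := n)) S" using S by simp
  moreover have "(pos(z := n)) ` S \<subseteq> {..<card S}"
    using pos(2) Suc.hyps(2) by (fastforce simp: image_subset_iff)
  moreover have "(pos(z := n)) x < (pos(z := n)) y" if "x \<in> S" "y \<in> S" "key x < key y" for x y
    using that pos(2,3) z(2)[of y] by (auto simp: image_subset_iff)
  ultimately show ?case by blast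
qed

text \<open>Whether two intervals meet depends only on how left endpoints compare with right
  endpoints, so positions in the sorted list can replace the real numbers.\<close>

lemma interval_graph_endpoints:
  assumes "is_interval_graph G"
  obtains L R :: "'a \<Rightarrow> nat"
  where "inj_on L (pverts G)" "inj_on R (pverts G)"
    "\<And>v. v \<in> pverts G \<Longrightarrow> L v < R v" "\<And>v. v \<in> pverts G \<Longrightarrow> R v < 2 * card (pverts G)"
    "parcs G = {(u, v). u \<in> pverts G \<and> v \<in> pverts G \<and> u \<noteq> v \<and> L u < R v \<and> L v < R u}"
proof -
  interpret pair_graph G using assms by (simp add: is_interval_graph_def)
  obtain J :: "nat set" and I where I: "\<And>i. i \<in> J \<Longrightarrow> \<exists>a b. a \<le> b \<and> I i = {a..b :: real}"
    and iso: "digraph_iso (with_proj G) (with_proj (interval_graph J I))"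
    using assms unfolding is_interval_graph_def by blast
  obtain a b where ab: "\<And>i. i \<in> J \<Longrightarrow> a i \<le> b i \<and> I i = {a i..b i}"
    using I by metis
  obtain h where h: "pre_digraph.digraph_isomorphism (with_proj G) h"
    and H: "with_proj (interval_graph J I) = app_iso h (with_proj G)"
    using iso by (auto simp: digraph_iso_def)
  define f where "f = iso_verts h"
  define K where "K = parcs (interval_graph J I)"
  have J: "J = f ` pverts G" and K: "K = iso_arcs h ` parcs G"
    and "iso_tail h = fst" "iso_head h = snd"
    using H by (auto simp: with_proj_def app_iso_def interval_graph_def f_def K_def)
  \<comment> \<open>Arcs are pairs on both sides, so compatibility with tails and heads forces the
    arc map to apply \<open>f\<close> to both components.\<close>
  then have arc: "iso_arcs h (u, v) = (f u, f v)" if "(u, v) \<in> parcs G" for u v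
    using h that by (fastforce simp: pre_digraph.digraph_isomorphism_def with_proj_def f_def prod_eq_iff)
  have f: "inj_on f (pverts G)"
    using h by (simp add: pre_digraph.digraph_isomorphism_def f_def)
  have arcs_iff: "(u, v) \<in> parcs G \<longleftrightarrow> (f u, f v) \<in> K" if "u \<in> pverts G" "v \<in> pverts G" for u v
  proof
    assume "(u, v) \<in> parcs G"
    then show "(f u, f v) \<in> K" using arc K by (metis imageI)
  next
    assume "(f u, f v) \<in> K"
    then obtain u' v' where *: "(u', v') \<in> parcs G" "(f u, f v) = (f u', f v')"
      using arc K by auto
    then show "(u, v) \<in> parcs G"
      using that f in_arcsD1 in_arcsD2 by (metis inj_onD prod.inject)
  qed
  \<comment> \<open>The order is lexicographic and \<open>False < True\<close>, so a left endpoint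
    precedes an equal right endpoint. This turns the weak comparison for closed intervals into a
    strict one of positions.\<close>
  define key where "key = (\<lambda>(v, side). (if side then b (f v) else a (f v), side))"
  obtain pos where pos: "inj_on pos (pverts G \<times> (UNIV :: bool set))"
    "pos ` (pverts G \<times> (UNIV :: bool set)) \<subseteq> {..<card (pverts G \<times> (UNIV :: bool set))}"
    "\<And>x y. x \<in> pverts G \<times> UNIV \<Longrightarrow> y \<in> pverts G \<times> UNIV \<Longrightarrow> key x < key y \<Longrightarrow> pos x < (pos y :: nat)"
    using ex_monotone_enumeration[of "pverts G \<times> (UNIV :: bool set)" key] pair_finite_verts by auto
  define L where "L v = pos (v, False)" for v
  define R where "R v = pos (v, True)" for v
  have less_iff: "L u < R v \<longleftrightarrow> a (f u) \<le> b (f v)" if "u \<in> pverts G" "v \<in> pverts G" for u v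
    using pos(3)[of "(u, False)" "(v, True)"] pos(3)[of "(v, True)" "(u, False)"] that
    by (fastforce simp: L_def R_def key_def)
  have ab': "a (f v) \<le> b (f v)" "I (f v) = {a (f v)..b (f v)}" if "v \<in> pverts G" for v
    using ab J that by auto
  show thesis
  proof
    show "inj_on L (pverts G)" "inj_on R (pverts G)"
      using pos(1) by (auto simp: inj_on_def L_def R_def)
    show "L v < R v" if "v \<in> pverts G" for v
      using that less_iff ab' by simp
    show "R v < 2 * card (pverts G)" if "v \<in> pverts G" for v
      using that pos(2) by (auto simp: R_def card_cartesian_product image_subset_iff mult.commute)
    have "(u, v) \<in> parcs G \<longleftrightarrow> u \<noteq> v \<and> L u < R v \<and> L v < R u"
      if uv: "u \<in> pverts G" "v \<in> pverts G" for u v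
    proof -
      have "f u \<noteq> f v \<longleftrightarrow> u \<noteq> v" using uv f by (auto dest: inj_onD)
      moreover have "I (f u) \<inter> I (f v) \<noteq> {} \<longleftrightarrow> a (f u) \<le> b (f v) \<and> a (f v) \<le> b (f u)"
        using ab' uv by auto
      ultimately show ?thesis
        using uv J by (auto simp: arcs_iff less_iff K_def interval_graph_def)
    qed
    then show "parcs G = {(u, v). u \<in> pverts G \<and> v \<in> pverts G \<and> u \<noteq> v \<and> L u < R v \<and> L v < R u}"
      by (auto dest: in_arcsD1 in_arcsD2)
  qed
qed

section \<open>Red degrees of partitions that refine endpoint blocks\<close>

locale endpoints =
  fixes V :: "'a set" and L R :: "'a \<Rightarrow> nat" and m :: nat
  assumes finite: "finite V"
    and inj_L: "inj_on L V" and inj_R: "inj_on R V"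
    and L_less_R: "v \<in> V \<Longrightarrow> L v < R v"
    and R_less: "v \<in> V \<Longrightarrow> R v < m * m"
begin

definition E :: "'a rel" where
  "E = {(u, v). u \<in> V \<and> v \<in> V \<and> u \<noteq> v \<and> L u < R v \<and> L v < R u}"

lemma sym_E: "sym E"
  by (auto simp: E_def sym_def)

text \<open>An edge between the two parts bounds the \<open>h\<close>-values of left endpoints by
  those of right endpoints, and a non-edge reverses one of these bounds. The values are constant on
  each part, so equality follows. As the parts are distinct, the non-edge does not come from a
  vertex paired with itself.\<close>

lemma red_quotient:
  fixes h :: "nat \<Rightarrow> nat"
  assumes "mono h" "refines_on V \<rho> (\<lambda>v. (h (L v), h (R v)))"
    and "(\<rho> u, y) \<in> red (quotient_trigraph V E \<rho>)" "u \<in> V"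
  shows "y \<in> \<rho> ` {v \<in> V. h (R v) = h (L u) \<or> h (L v) = h (R u)}"
proof -
  obtain u1 v1 u2 v2 where V: "u1 \<in> V" "v1 \<in> V" "u2 \<in> V" "v2 \<in> V"
    and \<rho>: "\<rho> u1 = \<rho> u" "\<rho> v1 = y" "\<rho> u2 = \<rho> u" "\<rho> v2 = y" "y \<noteq> \<rho> u"
    and E1: "(u1, v1) \<in> E" and E2: "(u2, v2) \<notin> E"
    using assms(3) unfolding quotient_trigraph_def by auto
  have h: "h (L u1) = h (L u)" "h (R u1) = h (R u)" "h (L u2) = h (L u)" "h (R u2) = h (R u)"
    "h (L v2) = h (L v1)" "h (R v2) = h (R v1)"
    using assms(2,4) V \<rho> unfolding refines_on_def by (metis prod.inject)+
  have "R v2 \<le> L u2 \<or> R u2 \<le> L v2"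
    using E2 V \<rho> by (auto simp: E_def)
  then have "h (R v2) \<le> h (L u2) \<or> h (R u2) \<le> h (L v2)"
    using \<open>mono h\<close> by (auto dest: monoD)
  moreover have "h (L u1) \<le> h (R v1)" "h (L v1) \<le> h (R u1)"
    using E1 \<open>mono h\<close> by (auto simp: E_def intro: monoD)
  ultimately have "h (R v1) = h (L u) \<or> h (L v1) = h (R u)"
    using h by auto
  then show ?thesis using V \<rho> by blast
qed

text \<open>Each part of \<open>\<rho>\<close> is a union of fibres of \<open>f\<close>, so values
  of \<open>f\<close> can be counted instead of red neighbours. Taking \<open>id\<close> for
  \<open>f\<close> counts vertices while cells are formed; \<open>cell k\<close> counts cells while
  blocks are united.\<close>

lemma degree_bounded_quotient:
  fixes h :: "nat \<Rightarrow> nat"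
  assumes "mono h" "refines_on V \<rho> (\<lambda>v. (h (L v), h (R v)))" "refines_on V f \<rho>"
    and d: "\<And>u. u \<in> V \<Longrightarrow> card (f ` {v \<in> V. h (R v) = h (L u) \<or> h (L v) = h (R u)}) \<le> d"
  shows "degree_bounded d (quotient_trigraph V E \<rho>)"
  unfolding degree_bounded_def red_degree_def
proof clarsimp
  fix u assume u: "u \<in> V"
  define W where "W = {v \<in> V. h (R v) = h (L u) \<or> h (L v) = h (R u)}"
  have W: "W \<subseteq> V" "finite W" using finite by (auto simp: W_def)
  \<comment> \<open>On \<open>W\<close>, the map \<open>\<rho>\<close> factors through
    \<open>f\<close>: \<open>r\<close> evaluates \<open>\<rho>\<close> at a representative of the
    fibre.\<close>
  define r where "r y = \<rho> (inv_into W f y)" for y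
  have "\<rho> v = r (f v)" if "v \<in> W" for v
  proof -
    have "f (inv_into W f (f v)) = f v" "inv_into W f (f v) \<in> W"
      using that by (auto simp: f_inv_into_f inv_into_into)
    then show ?thesis using assms(3) that W(1) unfolding r_def refines_on_def by (metis subsetD)
  qed
  then have "\<rho> ` W \<subseteq> r ` f ` W" by auto
  then have "card (\<rho> ` W) \<le> card (f ` W)"
    using W(2) by (meson card_image_le card_mono finite_imageI le_trans)
  moreover have "{y. (\<rho> u, y) \<in> red (quotient_trigraph V E \<rho>)} \<subseteq> \<rho> ` W"
    using red_quotient[OF assms(1,2) _ u] by (auto simp: W_def)
  then have "card {y. (\<rho> u, y) \<in> red (quotient_trigraph V E \<rho>)} \<le> card (\<rho> ` W)"
    using W(2) by (intro card_mono) auto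
  ultimately show "card {y. (\<rho> u, y) \<in> red (quotient_trigraph V E \<rho>)} \<le> d"
    using d[OF u] by (simp add: W_def)
qed

text \<open>Truncated subtraction makes the first \<open>k + 1\<close> blocks of \<open>m\<close> endpoints into one.\<close>

definition blk :: "nat \<Rightarrow> nat \<Rightarrow> nat" where
  "blk k x = x div m - k"

definition cell :: "nat \<Rightarrow> 'a \<Rightarrow> nat \<times> nat" where
  "cell k v = (blk k (L v), blk k (R v))"

lemma mono_blk: "mono (blk k)"
  by (auto simp: mono_def blk_def intro!: diff_le_mono div_le_mono)

lemma blk_less:
  assumes "v \<in> V"
  shows "blk k (L v) \<le> blk k (R v)" "blk k (R v) < m"
proof -
  show "blk k (L v) \<le> blk k (R v)"
    using mono_blk L_less_R[OF assms] by (simp add: monoD)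
  have "R v div m < m"
    using R_less[OF assms] by (simp add: less_mult_imp_div_less)
  then show "blk k (R v) < m" by (simp add: blk_def)
qed

lemma blk_Suc: "blk (Suc k) x = blk k x - 1"
  by (simp add: blk_def)

section \<open>Counting the endpoints and cells that can be red neighbours\<close>

lemma card_blk_le:
  assumes "inj_on P V" "V \<noteq> {}"
  shows "card {v \<in> V. blk 0 (P v) = c} \<le> m"
proof -
  \<comment> \<open>A vertex has \<open>R v < m * m\<close>, which excludes \<open>m = 0\<close>,
    where the division would degenerate.\<close>
  have "m > 0" using R_less assms(2) by fastforce
  have "P ` {v \<in> V. blk 0 (P v) = c} \<subseteq> {c * m..<c * m + m}"
  proof clarsimp
    fix v assume "c = blk 0 (P v)"
    then show "blk 0 (P v) * m \<le> P v \<and> P v < blk 0 (P v) * m + m"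
      using dividend_less_div_times[OF \<open>m > 0\<close>, of "P v"] by (simp add: blk_def add.commute)
  qed
  moreover have "inj_on P {v \<in> V. blk 0 (P v) = c}"
    using assms(1) by (rule inj_on_subset) auto
  ultimately show ?thesis
    using card_inj_on_le[of P "{v \<in> V. blk 0 (P v) = c}" "{c * m..<c * m + m}"] by simp
qed

lemma vertex_count:
  assumes "u \<in> V"
  shows "card {v \<in> V. blk 0 (R v) = blk 0 (L u) \<or> blk 0 (L v) = blk 0 (R u)} \<le> 2 * m"
proof -
  have "{v \<in> V. blk 0 (R v) = blk 0 (L u) \<or> blk 0 (L v) = blk 0 (R u)} =
      {v \<in> V. blk 0 (R v) = blk 0 (L u)} \<union> {v \<in> V. blk 0 (L v) = blk 0 (R u)}"
    by auto
  also have "card \<dots> \<le> m + m"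
    using card_blk_le[OF inj_R] card_blk_le[OF inj_L] assms
    by (intro order_trans[OF card_Un_le] add_mono) auto
  finally show ?thesis by simp
qed

text \<open>Cells of level \<open>k\<close> are points with x \<le> y < m, while the condition is
  one of level \<open>Suc k\<close>: y - 1 = i or x - 1 = j. By truncation, such an equation fixes
  one coordinate value if the right side is positive, but allows both 0 and 1 if it is 0; hence the
  cases.\<close>

lemma cell_count:
  assumes "u \<in> V"
  shows "card (cell k ` {v \<in> V. blk (Suc k) (R v) = blk (Suc k) (L u) \<or>
    blk (Suc k) (L v) = blk (Suc k) (R u)}) \<le> 2 * m"
proof -
  define i where "i = blk (Suc k) (L u)"
  define j where "j = blk (Suc k) (R u)"
  define C where "C = cell k ` {v \<in> V. blk (Suc k) (R v) = i \<or> blk (Suc k) (L v) = j}"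
  have "i \<le> j" using blk_less[OF assms] by (simp add: i_def j_def)
  have C: "x \<le> y \<and> y < m \<and> (y - 1 = i \<or> x - 1 = j)" if "(x, y) \<in> C" for x y
    using that blk_less by (auto simp: C_def cell_def blk_Suc)
  have "card C \<le> m + m"
  proof (cases "j = 0")
    case True
    \<comment> \<open>Here \<open>i = 0\<close> as well, and either equation gives x \<le> 1, the
      first one because x \<le> y.\<close>
    have "C \<subseteq> {0, 1} \<times> {..<m}"
    proof (rule subsetI)
      fix p assume "p \<in> C"
      then show "p \<in> {0, 1} \<times> {..<m}"
        using C[of "fst p" "snd p"] \<open>i \<le> j\<close> \<open>j = 0\<close> by (cases p) auto
    qed
    then have "card C \<le> card ({0 :: nat, 1} \<times> {..<m})"
      by (intro card_mono) auto
    then show ?thesis by (simp add: card_cartesian_product)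
  next
    case False
    \<comment> \<open>For positive \<open>j\<close> nothing is truncated: \<open>j + 1\<close> is
      the block of \<open>R u\<close> at level \<open>k\<close>.\<close>
    have j: "j + 1 < m"
      using False blk_less(2)[OF assms, of k] by (simp add: j_def blk_Suc)
    have "C \<subseteq> {(x, y) \<in> C. y - 1 = i} \<union> {j + 1} \<times> {..<m}"
    proof (rule subsetI)
      fix p assume "p \<in> C"
      then show "p \<in> {(x, y) \<in> C. y - 1 = i} \<union> {j + 1} \<times> {..<m}"
        using C[of "fst p" "snd p"] False by (cases p) auto
    qed
    moreover have "finite {(x, y) \<in> C. y - 1 = i}"
      by (rule finite_subset[of _ C]) (auto simp: C_def finite)
    ultimately have "card C \<le> card ({(x, y) \<in> C. y - 1 = i} \<union> {j + 1} \<times> {..<m})"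
      by (intro card_mono) auto
    also have "\<dots> \<le> card {(x, y) \<in> C. y - 1 = i} + m"
      by (rule order_trans[OF card_Un_le]) (simp add: card_cartesian_product)
    also have "card {(x, y) \<in> C. y - 1 = i} \<le> m"
    proof (cases "i = 0")
      case True
      \<comment> \<open>Two values of y remain, but only three cells with x \<le> y; and
        \<open>m\<close> is at least 3 since \<open>0 < j\<close> and
        \<open>j + 1 < m\<close>.\<close>
      have "{(x, y) \<in> C. y - 1 = i} \<subseteq> {(0, 0), (0, 1), (1, 1)}"
      proof (rule subsetI)
        fix p assume "p \<in> {(x, y) \<in> C. y - 1 = i}"
        then obtain x y where "p = (x, y)" "(x, y) \<in> C" "y - 1 = i" by auto
        then have "p = (x, y)" "y = 0 \<or> y = 1" "x \<le> y"
          using C[of x y] True by auto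
        then show "p \<in> {(0, 0), (0, 1), (1, 1)}"
          by auto
      qed
      from card_mono[OF _ this] show ?thesis using j False by simp
    next
      case i: False
      \<comment> \<open>Now y = i + 1, which leaves at most i + 2 cells, and
        \<open>i \<le> j\<close> with \<open>j + 1 < m\<close> gives i + 2 \<le> m.\<close>
      have "{(x, y) \<in> C. y - 1 = i} \<subseteq> {..i + 1} \<times> {i + 1}"
      proof (rule subsetI)
        fix p assume "p \<in> {(x, y) \<in> C. y - 1 = i}"
        then show "p \<in> {..i + 1} \<times> {i + 1}"
          using C[of "fst p" "snd p"] i by (cases p) auto
      qed
      from card_mono[OF _ this] show ?thesis
        using j \<open>i \<le> j\<close> by (simp add: card_cartesian_product)
    qed
    finally show ?thesis by simp
  qed
  then show ?thesis by (simp add: C_def i_def j_def)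
qed

section \<open>Assembling the contraction sequence\<close>

lemma chain_to_cells:
  "\<exists>\<sigma>. (bounded_contraction (2 * m))\<^sup>*\<^sup>* (quotient_trigraph V E id) (quotient_trigraph V E \<sigma>) \<and>
     refines_on V \<sigma> (cell k) \<and> refines_on V (cell k) \<sigma>"
proof (induction k)
  case 0
  have bd: "degree_bounded (2 * m) (quotient_trigraph V E \<sigma>)"
    if "refines_on V id \<sigma>" "refines_on V \<sigma> (cell 0)" for \<sigma>
  proof (rule degree_bounded_quotient[OF mono_blk])
    show "refines_on V \<sigma> (\<lambda>v. (blk 0 (L v), blk 0 (R v)))"
      using that(2) by (simp add: cell_def[abs_def])
    show "refines_on V id \<sigma>" by (fact that(1))
  qed (simp add: vertex_count)
  have "refines_on V id (cell 0)" by (simp add: refines_on_def)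
  then show ?case by (rule quotient_chain[OF finite sym_E]) (rule bd)
next
  case (Suc k)
  then obtain \<sigma> where
    chain: "(bounded_contraction (2 * m))\<^sup>*\<^sup>* (quotient_trigraph V E id) (quotient_trigraph V E \<sigma>)"
    and \<sigma>: "refines_on V \<sigma> (cell k)" "refines_on V (cell k) \<sigma>"
    by (elim exE conjE) (rule that)
  \<comment> \<open>Intermediate partitions refine only \<open>cell (Suc k)\<close>, so red edges
    are located by blocks of level \<open>Suc k\<close>. Their parts are unions of cells of level
    \<open>k\<close>, so those cells are counted.\<close>
  have bd: "degree_bounded (2 * m) (quotient_trigraph V E \<tau>)"
    if "refines_on V \<sigma> \<tau>" "refines_on V \<tau> (cell (Suc k))" for \<tau>
  proof (rule degree_bounded_quotient[OF mono_blk])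
    show "refines_on V \<tau> (\<lambda>v. (blk (Suc k) (L v), blk (Suc k) (R v)))"
      using that(2) by (simp add: cell_def[abs_def])
    show "refines_on V (cell k) \<tau>" using \<sigma>(2) that(1) by (rule refines_on_trans)
  qed (rule cell_count)
  have "refines_on V (cell k) (cell (Suc k))"
    by (auto simp: refines_on_def cell_def blk_Suc)
  with \<sigma>(1) have "refines_on V \<sigma> (cell (Suc k))" by (rule refines_on_trans)
  then have "\<exists>\<tau>. (bounded_contraction (2 * m))\<^sup>*\<^sup>* (quotient_trigraph V E \<sigma>) (quotient_trigraph V E \<tau>) \<and>
      refines_on V \<tau> (cell (Suc k)) \<and> refines_on V (cell (Suc k)) \<tau>"
    by (rule quotient_chain[OF finite sym_E]) (rule bd)
  then show ?case using rtranclp_trans[OF chain] by blast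
qed

lemma tww_le:
  assumes "pair_graph G" "pverts G = V" "parcs G = E" "V \<noteq> {}"
  shows "tww G \<le> 2 * m"
proof -
  have G: "quotient_trigraph V E id = trigraph_of G"
    using quotient_trigraph_id assms by metis
  obtain \<sigma> where chain: "(bounded_contraction (2 * m))\<^sup>*\<^sup>* (quotient_trigraph V E id) (quotient_trigraph V E \<sigma>)"
    and \<sigma>: "refines_on V (cell m) \<sigma>"
    using chain_to_cells by blast
  \<comment> \<open>All original block indices are below \<open>m\<close>, so subtracting
    \<open>m\<close> truncates them to 0 and a single part is left.\<close>
  have "cell m v = (0, 0)" if "v \<in> V" for v
    using blk_less[OF that, of 0] by (simp add: cell_def blk_def)
  with \<sigma> have "\<sigma> u = \<sigma> v" if "u \<in> V" "v \<in> V" for u v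
    using that unfolding refines_on_def by metis
  moreover obtain v where "v \<in> V" using assms(4) by blast
  ultimately have "\<sigma> ` V = {\<sigma> v}" by blast
  then have "card (tverts (quotient_trigraph V E \<sigma>)) = 1" by auto
  moreover have "degree_bounded (2 * m) (trigraph_of G)"
    by (simp add: degree_bounded_def red_degree_def trigraph_of_def)
  ultimately show ?thesis
    using tww_le_chain[OF assms(1)] chain unfolding G by blast
qed

end

section \<open>The explicit bound and its asymptotic form\<close>

lemma tww_interval_graph_le:
  assumes "is_interval_graph G" "card (pverts G) \<ge> 1"
  shows "int (tww G) \<le> 2 * \<lceil>sqrt (2 * real (card (pverts G)))\<rceil>"
proof -
  interpret pair_graph G using assms(1) by (simp add: is_interval_graph_def)
  define n where "n = card (pverts G)"
  define m where "m = nat \<lceil>sqrt (2 * real n)\<rceil>"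
  \<comment> \<open>The ceiling is therefore non-negative, and \<open>nat\<close> does not change
    it.\<close>
  have "-1 < sqrt (2 * real n)" by (rule less_le_trans[of _ 0]) auto
  then have m: "int m = \<lceil>sqrt (2 * real n)\<rceil>" by (simp add: m_def)
  then have "sqrt (2 * real n) \<le> real m"
    by (metis le_of_int_ceiling of_int_of_nat_eq)
  then have "2 * real n \<le> (real m)\<^sup>2"
    by (rule sqrt_le_D)
  then have "real (2 * n) \<le> real (m * m)"
    by (simp add: power2_eq_square)
  \<comment> \<open>The \<open>m\<close> blocks of size \<open>m\<close> have room for all
    \<open>2 * n\<close> endpoints.\<close>
  then have nm: "2 * n \<le> m * m"
    by (simp only: of_nat_le_iff)
  obtain L R where LR: "inj_on L (pverts G)" "inj_on R (pverts G)"
    "\<And>v. v \<in> pverts G \<Longrightarrow> L v < (R v :: nat)" "\<And>v. v \<in> pverts G \<Longrightarrow> R v < 2 * n"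
    "parcs G = {(u, v). u \<in> pverts G \<and> v \<in> pverts G \<and> u \<noteq> v \<and> L u < R v \<and> L v < R u}"
    using interval_graph_endpoints[OF assms(1)] unfolding n_def by blast
  have R_less: "R v < m * m" if "v \<in> pverts G" for v
    using LR(4)[OF that] nm by (rule less_le_trans)
  interpret endpoints "pverts G" L R m
    by unfold_locales (fact pair_finite_verts LR(1-3) R_less)+
  have "tww G \<le> 2 * m"
    using assms(2) LR(5) by (intro tww_le) (auto simp: E_def pair_graph_axioms)
  then show ?thesis using m by (simp add: n_def)
qed

theorem theorem5p1:
  shows "(\<forall>(G :: 'a pair_pre_digraph) n.
            is_interval_graph G \<longrightarrow> card (pverts G) = n \<longrightarrow> n \<ge> 1 \<longrightarrow>
            int (tww G) \<le> 2 * \<lceil>sqrt (2 * real n)\<rceil>) \<and>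
         (\<lambda>G :: 'a pair_pre_digraph. real (tww G))
           \<in> O[interval_graphs_at_top](\<lambda>G. sqrt (real (card (pverts G))))"
proof
  show "\<forall>(G :: 'a pair_pre_digraph) n.
      is_interval_graph G \<longrightarrow> card (pverts G) = n \<longrightarrow> n \<ge> 1 \<longrightarrow>
      int (tww G) \<le> 2 * \<lceil>sqrt (2 * real n)\<rceil>"
    using tww_interval_graph_le by blast
  \<comment> \<open>Rounding up costs less than 1 before doubling, and 1 is at most the square root
    of a positive number of vertices; this gives the constant.\<close>
  have "real (tww G) \<le> (2 * sqrt 2 + 2) * sqrt (real (card (pverts G)))"
    if "is_interval_graph G" "card (pverts G) \<ge> 1" for G :: "'a pair_pre_digraph"
  proof -
    let ?s = "sqrt (real (card (pverts G)))"
    have "real_of_int (int (tww G)) \<le> real_of_int (2 * \<lceil>sqrt (2 * real (card (pverts G)))\<rceil>)"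
      using tww_interval_graph_le[OF that] by (simp only: of_int_le_iff)
    also have "\<dots> \<le> 2 * (sqrt 2 * ?s + 1)"
      using mult_left_mono[OF of_int_ceiling_le_add_one[of "sqrt (2 * real (card (pverts G)))"], of 2]
      by (simp only: real_sqrt_mult of_int_mult of_int_numeral zero_le_numeral)
    also have "\<dots> \<le> 2 * (sqrt 2 * ?s + ?s)"
      using that(2) by simp
    finally show ?thesis by (simp add: algebra_simps)
  qed
  then show "(\<lambda>G :: 'a pair_pre_digraph. real (tww G))
      \<in> O[interval_graphs_at_top](\<lambda>G. sqrt (real (card (pverts G))))"
    by (intro bigoI[where c = "2 * sqrt 2 + 2"])
      (auto simp: eventually_interval_graphs_at_top intro!: exI[of _ 1])
qed

end
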